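(* Assume $\mathsf{CH}$. For every $p$-point $\mathscr{U}$ there is a $\mathscr{U}$-encompassing maximal ideal independent family $\mathscr{I}$ such that for every $A\in\mathscr{I}$ the complemented filter $\mathcal{F}(\mathscr{I},A)$ is a $p$-point.
   Context: For $A,B\subseteq\omega$, $A\subseteq^* B$ means $A\setminus B$ is finite. A family $\mathscr{I}\subseteq[\omega]^\omega$ is ideal independent if whenever $X_0,\dots,X_{n-1},A\in\mathscr{I}$ and $A\subseteq^*\bigcup_{i<n}X_i$, then $X_i=A$ for some $i<n$; it is maximal ideal independent if it is maximal under inclusion among ideal independent families. For $A\in\mathscr{I}$, the complemented filter $\mathcal{F}(\mathscr{I},A)$ is the filter on $\omega$ generated by $\{A\setminus\bigcup F:F\in[\mathscr{I}]^{<\omega},\ A\notin F\}$. A $p$-point is a non-principal ultrafilter $\mathscr{U}$ on $\omega$ such that every countable subfamily of $\mathscr{U}$ has a pseudo-intersection (a $B\in[\omega]^\omega$ with $B\subseteq^*$ each member) in $\mathscr{U}$. For an ultrafilter $\mathscr{U}$, a maximal ideal independent family $\mathscr{I}$ is $\mathscr{U}$-encompassing if (1) $\mathscr{U}\cap\mathscr{I}=\emptyset$, and (2) for every $X\in\mathscr{U}$ the set $\{A\in\mathscr{I}: X\in\mathcal{F}(\mathscr{I},A)\}$ is co-countable in $\mathscr{I}$. *)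

theory Defs
  imports Main "HOL-Library.Countable_Set"
begin

unbundle cardinal_syntax

definition CH :: bool where
  "CH \<longleftrightarrow> |UNIV :: nat set set| =o cardSuc natLeq"

definition almost_subset :: "nat set \<Rightarrow> nat set \<Rightarrow> bool"  (infix \<open>\<subseteq>*\<close> 50) where
  "A \<subseteq>* B \<longleftrightarrow> finite (A - B)"

definition filter_sets :: "nat filter \<Rightarrow> nat set set" where
  "filter_sets U = {X. eventually (\<lambda>n. n \<in> X) U}"

text \<open>The filter \<open>bot\<close> of the library is the improper filter, in which every set is large;
  it is excluded explicitly.\<close>

definition ultrafilter :: "nat filter \<Rightarrow> bool" where
  "ultrafilter U \<longleftrightarrow> U \<noteq> bot \<and> (\<forall>X. X \<in> filter_sets U \<or> - X \<in> filter_sets U)"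

definition nonprincipal :: "nat filter \<Rightarrow> bool" where
  "nonprincipal U \<longleftrightarrow> (\<forall>S. U \<noteq> principal S)"

definition pseudo_intersection :: "nat set \<Rightarrow> nat set set \<Rightarrow> bool" where
  "pseudo_intersection B C \<longleftrightarrow> infinite B \<and> (\<forall>X\<in>C. B \<subseteq>* X)"

definition p_point :: "nat filter \<Rightarrow> bool" where
  "p_point U \<longleftrightarrow> ultrafilter U \<and> nonprincipal U \<and>
     (\<forall>C. C \<subseteq> filter_sets U \<and> countable C \<longrightarrow>
        (\<exists>B\<in>filter_sets U. pseudo_intersection B C))"

definition ideal_independent :: "nat set set \<Rightarrow> bool" where
  "ideal_independent I \<longleftrightarrow> (\<forall>A\<in>I. infinite A) \<and>
     (\<forall>(n::nat) X A. (\<forall>i<n. X i \<in> I) \<and> A \<in> I \<and> A \<subseteq>* (\<Union>i<n. X i) \<longrightarrow> (\<exists>i<n. X i = A))"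

definition maximal_ideal_independent :: "nat set set \<Rightarrow> bool" where
  "maximal_ideal_independent I \<longleftrightarrow> ideal_independent I \<and>
     (\<forall>J. ideal_independent J \<and> I \<subseteq> J \<longrightarrow> J = I)"

text \<open>The library orders filters by reverse inclusion of their systems of large sets, so the
  infimum of principal filters is the filter generated by the corresponding sets.\<close>

definition complemented_filter :: "nat set set \<Rightarrow> nat set \<Rightarrow> nat filter" where
  "complemented_filter I A =
     (INF F\<in>{F. finite F \<and> F \<subseteq> I \<and> A \<notin> F}. principal (A - \<Union>F))"

lemma filter_sets_complemented_filter:
  "X \<in> filter_sets (complemented_filter I A) \<longleftrightarrow>
     (\<exists>F. finite F \<and> F \<subseteq> I \<and> A \<notin> F \<and> A - \<Union>F \<subseteq> X)"
proof -
  define S where "S = {F. finite F \<and> F \<subseteq> I \<and> A \<notin> F}"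
  have "eventually (\<lambda>n. n \<in> X) (INF F\<in>S. principal (A - \<Union>F)) \<longleftrightarrow>
    (\<exists>F\<in>S. eventually (\<lambda>n. n \<in> X) (principal (A - \<Union>F)))"
  proof (rule eventually_INF_base)
    have "{} \<in> S" by (simp add: S_def)
    then show "S \<noteq> {}" by blast
  next
    fix F G assume "F \<in> S" "G \<in> S"
    then have "F \<union> G \<in> S" by (simp add: S_def)
    moreover have "principal (A - \<Union>(F \<union> G)) \<le> inf (principal (A - \<Union>F)) (principal (A - \<Union>G))"
      unfolding inf_principal principal_le_iff by blast
    ultimately show "\<exists>H\<in>S. principal (A - \<Union>H) \<le> inf (principal (A - \<Union>F)) (principal (A - \<Union>G))"
      by (rule bexI[rotated])
  qed
  also have "\<dots> \<longleftrightarrow> (\<exists>F\<in>S. A - \<Union>F \<subseteq> X)"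
    by (simp only: eventually_principal subset_iff Ball_def)
  also have "\<dots> \<longleftrightarrow> (\<exists>F. finite F \<and> F \<subseteq> I \<and> A \<notin> F \<and> A - \<Union>F \<subseteq> X)"
    unfolding S_def by blast
  finally show ?thesis
    by (simp only: filter_sets_def complemented_filter_def S_def mem_Collect_eq)
qed

definition encompassing :: "nat filter \<Rightarrow> nat set set \<Rightarrow> bool" where
  "encompassing U I \<longleftrightarrow> maximal_ideal_independent I \<and>
     filter_sets U \<inter> I = {} \<and>
     (\<forall>X\<in>filter_sets U.
        countable (I - {A\<in>I. X \<in> filter_sets (complemented_filter I A)}))"

end

(* By CH, well-order the subsets of \<omega> so that initial segments are countable, and treat a set B at
   each stage.  Given the countable family I built so far, the p-point U contains a set Y almost
   disjoint from the members of I and almost inside the earlier sets of U.  Each A \<in> I has an infinite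
   subset P A that is almost disjoint from the other members of I and is either inside B or disjoint
   from B.  Off Y and all the P A, everything is put into C, and C \<union> Y0, C \<union> Y1 are added to I, where
   Y0, Y1 are disjoint infinite subsets of Y outside U.  Removing C \<union> Y0 from A leaves P A up to a
   finite set, which decides B in the filter of every old A and adds a pseudo-intersection to it.
   Removing C \<union> Y1 from C \<union> Y0 leaves Y0, so the filters of the new sets contain all the earlier
   members of U. *)
theory Submission
  imports Defs "HOL-Library.Countable_Set_Type"
begin

section \<open>A well-order of the subsets of \<omega> in type \<omega>_1\<close>

text \<open>The cardinal order on the power set of \<omega> has initial segments of size below its
  cardinality, which is the successor of \<aleph>_0 under \<open>CH\<close>, so they are countable.
  \<open>lt\<close> is the strict part of this order.\<close>

lemma CH_imp_wellorder:
  assumes CH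
  obtains lt :: "nat set rel"
  where "wf lt" "trans lt" "total lt" "\<And>x. countable {y. (y, x) \<in> lt}"
    "\<And>S. countable S \<Longrightarrow> \<exists>x. \<forall>s\<in>S. (s, x) \<in> lt"
proof -
  define r where "r = |UNIV :: nat set set|"
  have wo: "Well_order r"
    unfolding r_def by (rule card_of_Well_order)
  have fld: "Field r = UNIV"
    by (simp add: r_def Field_card_of)
  have r: "r =o cardSuc natLeq"
    using assms by (simp add: CH_def r_def)
  have initial: "countable (underS r x)" for x
  proof -
    have "|underS r x| <o r"
      using card_of_underS[of r x] card_of_Card_order[of "UNIV :: nat set set"] fld
      unfolding r_def by blast
    then have "|underS r x| <o cardSuc natLeq"
      using r ordLess_ordIso_trans by blast
    then have "|underS r x| \<le>o natLeq"
      using cardSuc_ordLeq_ordLess[OF natLeq_Card_order card_of_Card_order] by blast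
    then show ?thesis
      by (simp add: countable_card_le_natLeq)
  qed
  have unc: "uncountable (UNIV :: nat set set)"
  proof
    assume "countable (UNIV :: nat set set)"
    then have "r \<le>o natLeq"
      by (simp add: countable_card_le_natLeq r_def)
    also have "natLeq <o cardSuc natLeq"
      by (simp add: cardSuc_greater natLeq_Card_order)
    finally show False
      using r not_ordLess_ordIso by blast
  qed
  have lin: "trans r" "antisym r" "total r" "refl r"
    using wo fld by (auto simp: order_on_defs)
  show thesis
  proof
    show "wf (r - Id)"
      using wo by (simp add: well_order_on_def)
    show "trans (r - Id)"
      using lin by (simp add: trans_diff_Id)
    show "total (r - Id)"
      using lin by simp
    show "countable {y. (y, x) \<in> r - Id}" for x
      using initial[of x] by (simp add: underS_def conj_commute)
    fix S :: "nat set set"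
    assume "countable S"
    \<comment> \<open>A countable set together with everything below its members is still countable,
      so some point lies outside it; by totality that point is strictly above all of
      \<open>S\<close>.\<close>
    then have "countable (S \<union> (\<Union>s\<in>S. underS r s))"
      using initial by blast
    then obtain x where "x \<notin> S \<union> (\<Union>s\<in>S. underS r s)"
      using unc by (metis UNIV_eq_I)
    then have x: "x \<notin> S" "s \<in> S \<Longrightarrow> x \<notin> underS r s" for s
      by blast+
    have "(s, x) \<in> r - Id" if "s \<in> S" for s
    proof -
      have "x \<noteq> s" using x(1) that by blast
      moreover have "(x, s) \<notin> r" using x(2)[OF that] \<open>x \<noteq> s\<close> by (simp add: underS_def)
      ultimately show ?thesis using lin(3) by (auto simp: total_on_def)
    qed
    then show "\<exists>x. \<forall>s\<in>S. (s, x) \<in> r - Id"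
      by blast
  qed
qed

section \<open>Ideal independent families\<close>

lemma ideal_independent_iff:
  "ideal_independent I \<longleftrightarrow>
    (\<forall>F A. finite F \<and> F \<subseteq> I \<and> A \<in> I \<and> A \<notin> F \<longrightarrow> infinite (A - \<Union>F))"
proof
  assume I: "ideal_independent I"
  show "\<forall>F A. finite F \<and> F \<subseteq> I \<and> A \<in> I \<and> A \<notin> F \<longrightarrow> infinite (A - \<Union>F)"
  proof (intro allI impI notI)
    fix F A
    assume *: "finite F \<and> F \<subseteq> I \<and> A \<in> I \<and> A \<notin> F" and fin: "finite (A - \<Union>F)"
    obtain n :: nat and X where X: "F = X ` {i. i < n}"
      using finite_imp_nat_seg_image_inj_on[of F] * by metis
    have "(\<Union>i<n. X i) = \<Union>F" "\<forall>i<n. X i \<in> I"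
      using * by (auto simp: X)
    then have "\<exists>i<n. X i = A"
      using conjunct2[OF I[unfolded ideal_independent_def], rule_format, of n X A] * fin
      by (auto simp: almost_subset_def)
    with * X show False by auto
  qed
next
  assume I: "\<forall>F A. finite F \<and> F \<subseteq> I \<and> A \<in> I \<and> A \<notin> F \<longrightarrow> infinite (A - \<Union>F)"
  show "ideal_independent I"
    unfolding ideal_independent_def almost_subset_def
  proof (intro conjI ballI allI impI)
    show "infinite A" if "A \<in> I" for A
      using I[rule_format, of "{}" A] that by simp
    fix n :: nat and X A
    assume "(\<forall>i<n. X i \<in> I) \<and> A \<in> I \<and> finite (A - (\<Union>i<n. X i))"
    then show "\<exists>i<n. X i = A"
      using I[rule_format, of "X ` {..<n}" A] by auto
  qed
qed

lemma ideal_independentD: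
  assumes "ideal_independent I" "finite F" "F \<subseteq> I" "A \<in> I" "A \<notin> F"
  shows "infinite (A - \<Union>F)"
  using assms unfolding ideal_independent_iff by blast

lemma ideal_independent_diff:
  assumes "ideal_independent I" "A \<in> I" "D \<in> I" "A \<noteq> D"
  shows "infinite (A - D)"
  using ideal_independentD[OF assms(1), of "{D}" A] assms by simp

text \<open>A failure of independence involves only the finitely many sets in
  \<open>insert A F\<close>, and these already lie in one member of the chain.\<close>

lemma ideal_independent_Union_chain:
  assumes K: "\<And>J. J \<in> K \<Longrightarrow> ideal_independent J" and chain: "subset.chain UNIV K"
  shows "ideal_independent (\<Union>K)"
  unfolding ideal_independent_iff
proof (intro allI impI)
  fix F A
  assume *: "finite F \<and> F \<subseteq> \<Union>K \<and> A \<in> \<Union>K \<and> A \<notin> F"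
  then have "finite (insert A F)" "insert A F \<subseteq> \<Union>K" "K \<noteq> {}"
    by auto
  then obtain J where "J \<in> K" "insert A F \<subseteq> J"
    using finite_subset_Union_chain chain by metis
  with K * show "infinite (A - \<Union>F)"
    by (intro ideal_independentD[of J]) auto
qed

text \<open>Diagonalization: enumerate \<open>G\<close> as \<open>g\<close> and choose
  \<open>a n \<ge> n\<close> in \<open>A\<close> outside \<open>g 0, ..., g n\<close>. Then
  \<open>g i\<close> can contain \<open>a n\<close> only for \<open>n < i\<close>.\<close>

lemma exists_almost_disjoint_subset:
  fixes A :: "nat set"
  assumes "countable G" and inf: "\<And>F. finite F \<Longrightarrow> F \<subseteq> G \<Longrightarrow> infinite (A - \<Union>F)"
  obtains Q where "infinite Q" "Q \<subseteq> A" "\<And>X. X \<in> G \<Longrightarrow> finite (Q \<inter> X)"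
proof (cases "G = {}")
  case True
  with inf[of "{}"] that[of A] show ?thesis by simp
next
  case False
  define g where "g = from_nat_into G"
  have g: "range g = G"
    using False assms(1) by (simp add: g_def range_from_nat_into)
  have "\<exists>a\<ge>n. a \<in> A - (\<Union>i\<le>n. g i)" for n :: nat
    using inf[of "g ` {..n}"] g unfolding infinite_nat_iff_unbounded_le by blast
  then obtain a where a: "\<And>n. n \<le> a n" "\<And>n. a n \<in> A - (\<Union>i\<le>n. g i)"
    by metis
  show ?thesis
  proof
    show "infinite (range a)"
      unfolding infinite_nat_iff_unbounded_le using a(1) by blast
    show "range a \<subseteq> A"
      using a(2) by blast
    fix X assume "X \<in> G"
    then obtain i where i: "X = g i"
      using g by blast
    have "range a \<inter> X \<subseteq> a ` {..<i}"
    proof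
      fix x assume "x \<in> range a \<inter> X"
      then obtain n where n: "x = a n" "a n \<in> g i"
        using i by blast
      then have "\<not> i \<le> n"
        using a(2)[of n] by auto
      with n show "x \<in> a ` {..<i}" by auto
    qed
    then show "finite (range a \<inter> X)"
      by (rule finite_subset) simp
  qed
qed

section \<open>Ultrafilters and p-points\<close>

lemma filter_sets_mono: "X \<in> filter_sets U \<Longrightarrow> X \<subseteq> Y \<Longrightarrow> Y \<in> filter_sets U"
  unfolding filter_sets_def by (auto elim: eventually_mono)

lemma filter_sets_Int: "X \<in> filter_sets U \<Longrightarrow> Y \<in> filter_sets U \<Longrightarrow> X \<inter> Y \<in> filter_sets U"
  unfolding filter_sets_def by (simp add: eventually_conj)

lemma ultrafilter_disjoint:
  assumes "ultrafilter U" "X \<in> filter_sets U" "Y \<in> filter_sets U"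
  shows "X \<inter> Y \<noteq> {}"
proof
  assume "X \<inter> Y = {}"
  with filter_sets_Int[OF assms(2,3)] have "{} \<in> filter_sets U" by simp
  with assms(1) show False
    by (simp add: ultrafilter_def filter_sets_def)
qed

lemma ultrafilter_Compl: "ultrafilter U \<Longrightarrow> X \<notin> filter_sets U \<Longrightarrow> - X \<in> filter_sets U"
  unfolding ultrafilter_def by blast

text \<open>Points can be removed from a finite large set one at a time until a large singleton
  appears, and an ultrafilter containing a singleton is principal.\<close>

lemma p_point_infinite:
  assumes "p_point U" "X \<in> filter_sets U"
  shows "infinite X"
proof
  have U: "ultrafilter U" "nonprincipal U"
    using assms(1) by (auto simp: p_point_def)
  assume "finite X"
  then show False
    using assms(2)
  proof (induction X)
    case empty
    then show ?case
      using ultrafilter_disjoint[OF U(1)] by blast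
  next
    case (insert x X)
    then have "- X \<in> filter_sets U"
      using ultrafilter_Compl U(1) by blast
    then have x: "{x} \<in> filter_sets U"
      using filter_sets_Int[OF insert.prems, of "- X"] by (auto elim: filter_sets_mono)
    have "eventually Q U \<longleftrightarrow> Q x" for Q
      using ultrafilter_disjoint[OF U(1) x, of "Collect Q"] filter_sets_mono[OF x, of "Collect Q"]
      by (auto simp: filter_sets_def)
    then have "U = principal {x}"
      by (simp add: filter_eq_iff eventually_principal)
    with U(2) show ?case
      by (auto simp: nonprincipal_def)
  qed
qed

section \<open>One stage of the construction\<close>

text \<open>\<open>D\<close> and \<open>E\<close> are the sets added to \<open>I\<close> at the
  stage that treats \<open>B\<close>. The clause on \<open>\<X>\<close> puts its members into the
  filters of \<open>D\<close> and \<open>E\<close>; the next two make \<open>A - D\<close> a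
  pseudo-intersection for the filter of each old \<open>A\<close> and let it decide
  \<open>B\<close>. The last clause rules out \<open>B\<close> as a later addition: either
  \<open>B\<close> is large and almost contains \<open>D - E\<close>, or \<open>D\<close> covers
  \<open>B\<close>, or \<open>D\<close> and \<open>B\<close> almost cover an old \<open>A\<close>.
  Asking for \<open>B \<subseteq> D \<inter> E\<close> also makes every number lie in two
  members.\<close>

definition extension_step ::
    "nat filter \<Rightarrow> nat set set \<Rightarrow> nat set set \<Rightarrow> nat set \<Rightarrow> nat set \<Rightarrow> nat set \<Rightarrow> bool" where
  "extension_step U I \<X> B D E \<longleftrightarrow>
     D \<notin> filter_sets U \<and> E \<notin> filter_sets U \<and> D \<notin> I \<and> E \<notin> I \<and> D \<noteq> E \<and>
     ideal_independent (I \<union> {D, E}) \<and>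
     (\<forall>X\<in>\<X>. D - E \<subseteq>* X \<and> E - D \<subseteq>* X) \<and>
     (\<forall>A\<in>I. \<forall>A'\<in>I. A \<noteq> A' \<longrightarrow> finite ((A - D) \<inter> A')) \<and>
     (\<forall>A\<in>I. A - D \<subseteq>* B \<or> A - D \<subseteq>* - B) \<and>
     (B \<in> filter_sets U \<or> B \<subseteq> D \<inter> E \<or> (\<exists>A\<in>I. A - D \<subseteq>* B))"

text \<open>Diagonalization gives a subset of \<open>A\<close> almost disjoint from the other
  members, and one of its two parts inside and outside \<open>B\<close> is infinite. For the last
  property \<open>P A\<close> must also be fully disjoint from the members enumerated before
  \<open>A\<close>, so that each \<open>A\<close> meets only finitely many of the other
  \<open>P A'\<close>.\<close>

lemma exists_deciding_subsets:
  assumes I: "countable I" "ideal_independent I"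
  obtains P where "\<And>A. A \<in> I \<Longrightarrow> infinite (P A)" "\<And>A. A \<in> I \<Longrightarrow> P A \<subseteq> A"
    "\<And>A. A \<in> I \<Longrightarrow> P A \<subseteq> B \<or> P A \<inter> B = {}"
    "\<And>A A'. A \<in> I \<Longrightarrow> A' \<in> I \<Longrightarrow> A \<noteq> A' \<Longrightarrow> finite (P A \<inter> A')"
    "\<And>A. A \<in> I \<Longrightarrow> finite (A \<inter> (\<Union>(P ` I)) - P A)"
proof -
  define idx where "idx = to_nat_on I"
  have inj: "inj_on idx I"
    using I(1) by (simp add: idx_def inj_on_to_nat_on)
  have fin: "finite {A'\<in>I. idx A' \<le> n}" for n
  proof (rule inj_on_finite[of idx])
    show "inj_on idx {A'\<in>I. idx A' \<le> n}"
      using inj by (rule inj_on_subset) blast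
    show "idx ` {A'\<in>I. idx A' \<le> n} \<subseteq> {..n}" by blast
  qed simp
  have "\<exists>P. infinite P \<and> P \<subseteq> A \<and> (P \<subseteq> B \<or> P \<inter> B = {}) \<and>
      (\<forall>A'\<in>I. A \<noteq> A' \<longrightarrow> finite (P \<inter> A')) \<and> (\<forall>A'\<in>I. idx A' < idx A \<longrightarrow> P \<inter> A' = {})"
    if A: "A \<in> I" for A
  proof -
    have "countable (I - {A})"
      using I(1) by blast
    moreover have "infinite (A - \<Union>F)" if "finite F" "F \<subseteq> I - {A}" for F
      using ideal_independentD[OF I(2) that(1) _ A] that(2) by blast
    ultimately obtain Q where Q: "infinite Q" "Q \<subseteq> A" "\<And>X. X \<in> I - {A} \<Longrightarrow> finite (Q \<inter> X)"
      by (metis exists_almost_disjoint_subset)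
    have "infinite (Q \<inter> B) \<or> infinite (Q - B)"
      using Q(1) by (metis Un_Diff_Int finite_UnI)
    then obtain R where R: "infinite R" "R \<subseteq> Q" "R \<subseteq> B \<or> R \<inter> B = {}"
      by (metis Diff_disjoint Diff_subset Int_commute Int_lower1 Int_lower2)
    \<comment> \<open>Only finitely many members precede \<open>A\<close> and each meets
      \<open>Q\<close> in a finite set, so discarding \<open>S\<close> keeps the subset
      infinite.\<close>
    define S where "S = (\<Union>A'\<in>{A'\<in>I. idx A' < idx A}. Q \<inter> A')"
    have "finite S"
      unfolding S_def
    proof (rule finite_UN_I)
      show "finite {A'\<in>I. idx A' < idx A}"
        using fin[of "idx A"] by (rule rev_finite_subset) auto
      show "finite (Q \<inter> A')" if "A' \<in> {A'\<in>I. idx A' < idx A}" for A'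
        using Q(3)[of A'] that by auto
    qed
    then have "infinite (R - S)"
      using R(1) by simp
    moreover have "finite ((R - S) \<inter> A')" if "A' \<in> I" "A \<noteq> A'" for A'
      using Q(3)[of A'] that R(2) by (auto elim!: rev_finite_subset)
    moreover have "(R - S) \<inter> A' = {}" if "A' \<in> I" "idx A' < idx A" for A'
      using that R(2) by (auto simp: S_def)
    ultimately show ?thesis
      using R(2,3) Q(2) by (intro exI[of _ "R - S"]) blast
  qed
  then have "\<exists>P. \<forall>A\<in>I. infinite (P A) \<and> P A \<subseteq> A \<and> (P A \<subseteq> B \<or> P A \<inter> B = {}) \<and>
      (\<forall>A'\<in>I. A \<noteq> A' \<longrightarrow> finite (P A \<inter> A')) \<and> (\<forall>A'\<in>I. idx A' < idx A \<longrightarrow> P A \<inter> A' = {})"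
    by (intro bchoice ballI)
  then obtain P where "\<forall>A\<in>I. infinite (P A) \<and> P A \<subseteq> A \<and> (P A \<subseteq> B \<or> P A \<inter> B = {}) \<and>
      (\<forall>A'\<in>I. A \<noteq> A' \<longrightarrow> finite (P A \<inter> A')) \<and> (\<forall>A'\<in>I. idx A' < idx A \<longrightarrow> P A \<inter> A' = {})" ..
  then have P: "\<And>A. A \<in> I \<Longrightarrow> infinite (P A)" "\<And>A. A \<in> I \<Longrightarrow> P A \<subseteq> A"
    "\<And>A. A \<in> I \<Longrightarrow> P A \<subseteq> B \<or> P A \<inter> B = {}"
    "\<And>A A'. A \<in> I \<Longrightarrow> A' \<in> I \<Longrightarrow> A \<noteq> A' \<Longrightarrow> finite (P A \<inter> A')"
    "\<And>A A'. A \<in> I \<Longrightarrow> A' \<in> I \<Longrightarrow> idx A' < idx A \<Longrightarrow> P A \<inter> A' = {}"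
    by simp_all
  have "finite (A \<inter> \<Union>(P ` I) - P A)" if A: "A \<in> I" for A
  proof (rule finite_subset)
    show "A \<inter> \<Union>(P ` I) - P A \<subseteq> (\<Union>A'\<in>{A'\<in>I. idx A' \<le> idx A} - {A}. P A' \<inter> A)"
      using P(5)[OF _ A] by (fastforce simp: not_le[symmetric])
    show "finite (\<Union>A'\<in>{A'\<in>I. idx A' \<le> idx A} - {A}. P A' \<inter> A)"
      using fin P(4)[OF _ A] by blast
  qed
  with P show thesis
    using that by blast
qed

lemma exists_extension_step:
  assumes U: "p_point U" and I: "countable I" "ideal_independent I" "filter_sets U \<inter> I = {}"
    and \<X>: "countable \<X>" "\<X> \<subseteq> filter_sets U"
  shows "\<exists>D E. extension_step U I \<X> B D E"
proof -
  have ultra: "ultrafilter U"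
    using U by (simp add: p_point_def)
  \<comment> \<open>With \<open>Y\<close> inside \<open>B'\<close>, a set \<open>B\<close> outside
    \<open>U\<close> is disjoint from \<open>Y\<close>.\<close>
  define B' where "B' = (if B \<in> filter_sets U then B else - B)"
  have B': "B' \<in> filter_sets U"
    using ultrafilter_Compl[OF ultra] by (simp add: B'_def)
  have "\<X> \<union> uminus ` I \<subseteq> filter_sets U" "countable (\<X> \<union> uminus ` I)"
    using \<X> I ultrafilter_Compl[OF ultra] by auto
  \<comment> \<open>The p-point property is applied to \<open>\<X>\<close> and the complements of
    the members of \<open>I\<close> together, which are large because \<open>I\<close> misses
    \<open>U\<close>.\<close>
  then obtain Z where Z: "Z \<in> filter_sets U" "pseudo_intersection Z (\<X> \<union> uminus ` I)"
    using U unfolding p_point_def by metis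
  define Y where "Y = Z \<inter> B'"
  have Y: "Y \<in> filter_sets U"
    using Z(1) B' by (simp add: Y_def filter_sets_Int)
  have YX: "finite (Y - X)" if "X \<in> \<X>" for X
    using Z(2) that unfolding pseudo_intersection_def almost_subset_def Y_def
    by (auto elim!: rev_finite_subset dest!: bspec[of _ _ X])
  have YI: "finite (Y \<inter> A)" if "A \<in> I" for A
    using Z(2) that unfolding pseudo_intersection_def almost_subset_def Y_def
    by (auto elim!: rev_finite_subset dest!: bspec[of _ _ "- A"])
  obtain Y0 Y1 where Y01: "infinite Y0" "infinite Y1" "Y0 \<inter> Y1 = {}" "Y0 \<subseteq> Y" "Y1 \<subseteq> Y"
    "Y0 \<notin> filter_sets U" "Y1 \<notin> filter_sets U"
  proof -
    obtain W :: "nat \<Rightarrow> nat set" where W: "pairwise (\<lambda>i j. disjnt (W i) (W j)) UNIV"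
      "(\<Union>i. W i) \<subseteq> Y" "\<And>i. infinite (W i)"
      using infinite_infinite_partition p_point_infinite[OF U Y] by blast
    have disj: "W i \<inter> W j = {}" if "i \<noteq> j" for i j
      using W(1) that by (auto simp: pairwise_def disjnt_def)
    have le: "W i \<subseteq> Y" for i
      using W(2) by blast
    have notU: "W i \<notin> filter_sets U \<or> W j \<notin> filter_sets U" if "i \<noteq> j" for i j
      using ultrafilter_disjoint[OF ultra] disj[OF that] by blast
    \<comment> \<open>Among three pairwise disjoint sets at most one is in \<open>U\<close>, so two
      remain for \<open>Y0\<close> and \<open>Y1\<close>.\<close>
    have "\<exists>i j. i \<noteq> j \<and> W i \<notin> filter_sets U \<and> W j \<notin> filter_sets U"
      using notU[of 0 1] notU[of 0 2] notU[of 1 2]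
      by (metis one_neq_zero zero_neq_numeral one_eq_numeral_iff semiring_norm(85))
    then show thesis
      using that W(3) disj le by metis
  qed
  obtain P where P: "\<And>A. A \<in> I \<Longrightarrow> infinite (P A)" "\<And>A. A \<in> I \<Longrightarrow> P A \<subseteq> A"
    "\<And>A. A \<in> I \<Longrightarrow> P A \<subseteq> B \<or> P A \<inter> B = {}"
    "\<And>A A'. A \<in> I \<Longrightarrow> A' \<in> I \<Longrightarrow> A \<noteq> A' \<Longrightarrow> finite (P A \<inter> A')"
    "\<And>A. A \<in> I \<Longrightarrow> finite (A \<inter> (\<Union>(P ` I)) - P A)"
    using exists_deciding_subsets[OF I(1,2)] by blast
  define C where "C = - (Y \<union> \<Union>(P ` I))"
  define D where "D = C \<union> Y0"
  define E where "E = C \<union> Y1"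
  \<comment> \<open>\<open>C\<close> is disjoint from the large set \<open>Y\<close>, so adding it
    to a small set leaves that set small.\<close>
  have notU: "C \<union> V \<notin> filter_sets U" if V: "V \<notin> filter_sets U" for V
  proof
    assume "C \<union> V \<in> filter_sets U"
    moreover have "Y \<inter> - V \<in> filter_sets U"
      using Y ultrafilter_Compl[OF ultra V] by (rule filter_sets_Int)
    ultimately show False
      using ultrafilter_disjoint[OF ultra] unfolding C_def by blast
  qed
  have diff: "D - E = Y0" "E - D = Y1"
    using Y01(3-5) by (auto simp: D_def E_def C_def)
  have Y0A: "finite (Y0 \<inter> A)" and Y1A: "finite (Y1 \<inter> A)" if "A \<in> I" for A
    using YI[OF that] Y01(4,5) by (auto elim!: rev_finite_subset)
  have notI: "D \<notin> I" "E \<notin> I"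
    using Y0A[of D] Y1A[of E] Y01(1,2) by (auto simp: D_def E_def Int_absorb2)
  \<comment> \<open>Outside \<open>D\<close> only \<open>Y\<close> and the sets \<open>P A'\<close>
    remain; \<open>A\<close> meets \<open>Y\<close> finitely and meets the sets \<open>P A'\<close>
    in \<open>P A\<close> up to finitely many points.\<close>
  have AD: "finite (A - D - P A)" if "A \<in> I" for A
  proof (rule finite_subset)
    show "A - D - P A \<subseteq> (Y \<inter> A) \<union> (A \<inter> (\<Union>(P ` I)) - P A)"
      by (auto simp: D_def C_def)
    show "finite ((Y \<inter> A) \<union> (A \<inter> (\<Union>(P ` I)) - P A))"
      using YI P(5) that by blast
  qed
  have "finite ((A - D) \<inter> A')" if "A \<in> I" "A' \<in> I" "A \<noteq> A'" for A A'
    using finite_UnI[OF AD[OF that(1)] P(4)[OF that]] by (rule rev_finite_subset) blast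
  moreover have dec: "A - D \<subseteq>* V" if "A \<in> I" "P A \<subseteq> V" for A V
    unfolding almost_subset_def using AD[OF that(1)] by (rule rev_finite_subset) (use that in blast)
  have "A - D \<subseteq>* B \<or> A - D \<subseteq>* - B" if "A \<in> I" for A
    using P(3)[OF that] dec[OF that] by blast
  moreover have "B \<in> filter_sets U \<or> B \<subseteq> D \<inter> E \<or> (\<exists>A\<in>I. A - D \<subseteq>* B)"
  proof (cases "B \<in> filter_sets U \<or> (\<exists>A\<in>I. P A \<subseteq> B)")
    case True
    with dec show ?thesis by blast
  next
    case False
    \<comment> \<open>Here \<open>B\<close> misses \<open>Y\<close> by the choice of
      \<open>B'\<close>, and every \<open>P A\<close> misses \<open>B\<close> because none is
      contained in it.\<close>
    then have "B \<subseteq> C"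
      using P(3) by (auto simp: C_def Y_def B'_def)
    then show ?thesis by (auto simp: D_def E_def)
  qed
  moreover have "\<forall>X\<in>\<X>. D - E \<subseteq>* X \<and> E - D \<subseteq>* X"
    using Y01(4,5) YX unfolding diff almost_subset_def
    by (meson Diff_mono finite_subset order_refl)
  moreover have "ideal_independent (I \<union> {D, E})"
    unfolding ideal_independent_iff
  proof (intro allI impI)
    fix F A
    assume *: "finite F \<and> F \<subseteq> I \<union> {D, E} \<and> A \<in> I \<union> {D, E} \<and> A \<notin> F"
    \<comment> \<open>It suffices to find an infinite subset of \<open>A\<close> almost disjoint
      from each member of \<open>F\<close>. The witnesses below are \<open>P A\<close> for an old
      \<open>A\<close>, \<open>Y0\<close> for \<open>D\<close> and \<open>Y1\<close> for
      \<open>E\<close>.\<close>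
    have core: "infinite (A - \<Union>F)"
      if V: "infinite V" "V \<subseteq> A" "\<And>A'. A' \<in> F \<Longrightarrow> finite (V \<inter> A')" for V
    proof -
      have "finite (\<Union>A'\<in>F. V \<inter> A')"
        using V(3) * by blast
      then have "infinite (V - (\<Union>A'\<in>F. V \<inter> A'))"
        using V(1) by simp
      then show ?thesis
        using V(2) by (auto elim!: contrapos_nn rev_finite_subset)
    qed
    consider "A \<in> I" | "A = D" | "A = E" using * by blast
    then show "infinite (A - \<Union>F)"
    proof cases
      case 1
      have "P A \<inter> D \<subseteq> Y0 \<inter> A" "P A \<inter> E \<subseteq> Y1 \<inter> A"
        using 1 P(2) by (auto simp: D_def E_def C_def)
      then have DE: "finite (P A \<inter> D)" "finite (P A \<inter> E)"
        using finite_subset[OF _ Y0A[OF 1]] finite_subset[OF _ Y1A[OF 1]] by simp_all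
      show ?thesis
        using P(1,2)[OF 1]
      proof (rule core)
        fix A' assume "A' \<in> F"
        then show "finite (P A \<inter> A')"
          using P(4)[OF 1, of A'] DE * by blast
      qed
    next
      case 2
      show ?thesis
      proof (rule core[OF Y01(1)])
        fix A' assume "A' \<in> F"
        then have "A' \<in> I \<or> A' = E" using * 2 by blast
        then show "finite (Y0 \<inter> A')"
          using Y0A diff(1) by (metis Diff_disjoint Int_commute finite.emptyI)
      qed (simp add: 2 D_def)
    next
      case 3
      show ?thesis
      proof (rule core[OF Y01(2)])
        fix A' assume "A' \<in> F"
        then have "A' \<in> I \<or> A' = D" using * 3 by blast
        then show "finite (Y1 \<inter> A')"
          using Y1A diff(2) by (metis Diff_disjoint Int_commute finite.emptyI)
      qed (simp add: 3 E_def)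
    qed
  qed
  moreover have "D \<notin> filter_sets U" "E \<notin> filter_sets U"
    using notU Y01(6,7) by (auto simp: D_def E_def)
  moreover have "D \<noteq> E"
    using diff Y01(1) by auto
  ultimately show ?thesis
    unfolding extension_step_def using notI by blast
qed

section \<open>Finite errors in complemented filters\<close>

text \<open>Each of the finitely many points of \<open>A - \<Union>F\<close> outside
  \<open>X\<close> lies in two members of \<open>I\<close>, one of which differs from
  \<open>A\<close>. Adding these members to \<open>F\<close> turns almost inclusion into
  inclusion.\<close>

lemma complemented_filter_finite_absorb:
  assumes two: "\<And>n. \<exists>D\<in>I. \<exists>E\<in>I. D \<noteq> E \<and> n \<in> D \<and> n \<in> E"
    and F: "finite F" "F \<subseteq> I" "A \<notin> F" "A - \<Union>F \<subseteq>* X"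
  shows "X \<in> filter_sets (complemented_filter I A)"
proof -
  have "\<exists>D\<in>I. D \<noteq> A \<and> n \<in> D" for n
    using two[of n] by metis
  then obtain d where d: "\<And>n. d n \<in> I" "\<And>n. d n \<noteq> A" "\<And>n. n \<in> d n"
    by metis
  define G where "G = F \<union> d ` (A - \<Union>F - X)"
  have "finite G" "G \<subseteq> I" "A \<notin> G" "A - \<Union>G \<subseteq> X"
    using F d by (auto simp: G_def almost_subset_def)
  then show ?thesis
    unfolding filter_sets_complemented_filter by blast
qed

section \<open>The recursion and the resulting family\<close>

theorem mainTheorem6:
  fixes U :: "nat filter"
  assumes CH
    and "p_point U"
  shows "\<exists>I. encompassing U I \<and> (\<forall>A\<in>I. p_point (complemented_filter I A))"
proof -
  obtain lt :: "nat set rel" where lt: "wf lt" "trans lt" "total lt"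
    and initial: "\<And>x. countable {y. (y, x) \<in> lt}"
    and bounded: "\<And>S. countable S \<Longrightarrow> \<exists>x. \<forall>s\<in>S. (s, x) \<in> lt"
    using CH_imp_wellorder[OF assms(1)] by metis
  have ultra: "ultrafilter U"
    using assms(2) by (simp add: p_point_def)
  define fam where "fam f S = (\<Union>z\<in>S. {fst (f z), snd (f z)})"
    for f :: "nat set \<Rightarrow> nat set \<times> nat set" and S
  define below where "below x = {z. (z, x) \<in> lt}" for x
  \<comment> \<open>For each set treated up to and including stage \<open>x\<close>, this collects
    whichever of the set and its complement lies in \<open>U\<close>. The filters of the two sets
    added at \<open>x\<close> will therefore decide all these sets.\<close>
  define \<X> where "\<X> x = {X \<in> filter_sets U. X \<in> insert x (below x) \<or> - X \<in> insert x (below x)}"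
    for x
  have X_countable: "countable (\<X> x)" for x
  proof (rule countable_subset)
    have "X \<in> uminus ` S" if "- X \<in> S" for X :: "nat set" and S
      using imageI[OF that, of uminus] by simp
    then show "\<X> x \<subseteq> insert x (below x) \<union> uminus ` insert x (below x)"
      unfolding \<X>_def by blast
    show "countable (insert x (below x) \<union> uminus ` insert x (below x))"
      using initial by (simp add: below_def)
  qed
  have fam_insert: "fam f (insert x S) = fam f S \<union> {fst (f x), snd (f x)}" for f x S
    by (auto simp: fam_def)
  have fam_mono: "S \<subseteq> T \<Longrightarrow> fam f S \<subseteq> fam f T" for f S T
    by (auto simp: fam_def)
  have le_chain: "insert y (below y) \<subseteq> insert z (below z) \<or> insert z (below z) \<subseteq> insert y (below y)"
    for y z
    using lt(2,3) unfolding below_def total_on_def by (blast dest: transD)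
  \<comment> \<open>For a downward closed set of stages, the families built through each of its
    stages form a chain. This serves both the start of stage \<open>x\<close>, with
    \<open>below x\<close>, and the final family, with \<open>UNIV\<close>.\<close>
  have indep_union: "ideal_independent (fam f S)"
    if "\<And>y. y \<in> S \<Longrightarrow> ideal_independent (fam f (insert y (below y)))"
      and "\<And>y. y \<in> S \<Longrightarrow> below y \<subseteq> S" for f S
  proof -
    define K where "K y = fam f (insert y (below y))" for y
    have "K y \<subseteq> K z \<or> K z \<subseteq> K y" for y z
      using le_chain[of y z] fam_mono unfolding K_def by metis
    then have "subset.chain UNIV (K ` S)"
      unfolding subset_chain_def by blast
    moreover have "ideal_independent J" if "J \<in> K ` S" for J
      using that \<open>\<And>y. y \<in> S \<Longrightarrow> ideal_independent (fam f (insert y (below y)))\<close>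
      by (auto simp: K_def)
    moreover have "fam f S = \<Union>(K ` S)"
      using that(2) unfolding K_def fam_def by blast
    ultimately show ?thesis
      using ideal_independent_Union_chain by metis
  qed
  have "\<exists>f. \<forall>x. extension_step U (fam f (below x)) (\<X> x) x (fst (f x)) (snd (f x))"
  \<comment> \<open>The requirement at \<open>x\<close> looks at \<open>f\<close> only below
    \<open>x\<close>, and \<open>exists_extension_step\<close> meets it once the earlier stages are
    correct.\<close>
  proof (rule dependent_wf_choice[OF lt(1)])
    fix f g :: "nat set \<Rightarrow> nat set \<times> nat set" and x r
    assume "\<And>z. (z, x) \<in> lt \<Longrightarrow> f z = g z"
    then have "fam f (below x) = fam g (below x)"
      by (auto simp: fam_def below_def)
    then show "extension_step U (fam f (below x)) (\<X> x) x (fst r) (snd r) =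
        extension_step U (fam g (below x)) (\<X> x) x (fst r) (snd r)"
      by simp
  next
    fix x and f :: "nat set \<Rightarrow> nat set \<times> nat set"
    assume *: "\<And>y. (y, x) \<in> lt \<Longrightarrow>
      extension_step U (fam f (below y)) (\<X> y) y (fst (f y)) (snd (f y))"
    have "countable (fam f (below x))"
      using initial[of x] by (simp add: fam_def below_def)
    moreover have "ideal_independent (fam f (below x))"
    proof (rule indep_union)
      show "ideal_independent (fam f (insert y (below y)))" if "y \<in> below x" for y
        using * that unfolding fam_insert by (simp add: below_def extension_step_def)
      show "below y \<subseteq> below x" if "y \<in> below x" for y
        using that lt(2) unfolding below_def by (blast dest: transD)
    qed
    moreover have "filter_sets U \<inter> fam f (below x) = {}"
      using * by (auto simp: fam_def below_def extension_step_def)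
    moreover have "\<X> x \<subseteq> filter_sets U"
      by (auto simp: \<X>_def)
    ultimately have "\<exists>D E. extension_step U (fam f (below x)) (\<X> x) x D E"
      by (intro exists_extension_step[OF assms(2)] X_countable)
    then show "\<exists>r. extension_step U (fam f (below x)) (\<X> x) x (fst r) (snd r)"
      by auto
  qed
  then obtain f where f: "\<And>x. extension_step U (fam f (below x)) (\<X> x) x (fst (f x)) (snd (f x))"
    by blast
  define D where "D x = fst (f x)" for x
  define E where "E x = snd (f x)" for x
  define J where "J x = fam f (below x)" for x
  define I where "I = fam f UNIV"
  have J_eq: "J x = D ` below x \<union> E ` below x" for x
    by (auto simp: J_def fam_def D_def E_def)
  have I_eq: "I = range D \<union> range E"
    by (auto simp: I_def fam_def D_def E_def)
  have J_le: "J x \<subseteq> I" for x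
    by (auto simp: J_eq I_eq)
  have DE_in: "D x \<in> I" "E x \<in> I" for x
    by (auto simp: I_eq)
  have step: "D x \<notin> filter_sets U" "E x \<notin> filter_sets U" "D x \<notin> J x" "E x \<notin> J x" "D x \<noteq> E x"
    and step_indep: "ideal_independent (J x \<union> {D x, E x})"
    and step_U: "X \<in> \<X> x \<Longrightarrow> D x - E x \<subseteq>* X \<and> E x - D x \<subseteq>* X"
    and step_pseudo: "A \<in> J x \<Longrightarrow> A' \<in> J x \<Longrightarrow> A \<noteq> A' \<Longrightarrow> finite ((A - D x) \<inter> A')"
    and step_decide: "A \<in> J x \<Longrightarrow> A - D x \<subseteq>* x \<or> A - D x \<subseteq>* - x"
    and step_max: "x \<in> filter_sets U \<or> x \<subseteq> D x \<inter> E x \<or> (\<exists>A\<in>J x. A - D x \<subseteq>* x)"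
    for x X A A'
    using f[of x] unfolding extension_step_def D_def E_def J_def by blast+
  have indep: "ideal_independent I"
    unfolding I_def
  proof (rule indep_union)
    show "ideal_independent (fam f (insert y (below y)))" for y
      using step_indep[of y] unfolding fam_insert by (simp add: J_def D_def E_def)
  qed simp
  have I_U: "filter_sets U \<inter> I = {}"
    using step(1,2) by (auto simp: I_eq)
  have D_new: "A \<noteq> D x" if "A \<in> J x" for A x
    using step(3) that by blast
  \<comment> \<open>Stage \<open>{n}\<close> provides the two members: \<open>{n}\<close> is not in
    \<open>U\<close>, and each \<open>A - D {n}\<close> is infinite, so only the alternative
    \<open>{n} \<subseteq> D {n} \<inter> E {n}\<close> is left.\<close>
  have two: "\<exists>D\<in>I. \<exists>E\<in>I. D \<noteq> E \<and> n \<in> D \<and> n \<in> E" for n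
  proof -
    have "{n} \<notin> filter_sets U"
      using p_point_infinite[OF assms(2), of "{n}"] by blast
    moreover have "\<not> A - D {n} \<subseteq>* {n}" if "A \<in> J {n}" for A
      using ideal_independent_diff[OF indep _ DE_in(1) D_new[OF that]] that J_le
      unfolding almost_subset_def by auto
    ultimately have "n \<in> D {n}" "n \<in> E {n}"
      using step_max[of "{n}"] by auto
    then show ?thesis
      using step(5) DE_in by metis
  qed
  note absorb = complemented_filter_finite_absorb[of I, OF two]
  have absorb1: "X \<in> filter_sets (complemented_filter I A)"
    if "V \<in> I" "A \<noteq> V" "A - V \<subseteq>* X" for A V X
    using absorb[of "{V}" A X] that by simp
  \<comment> \<open>For \<open>D x\<close> the set removed is \<open>E x\<close>, and vice
    versa.\<close>
  have CF_U: "X \<in> filter_sets (complemented_filter I A)"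
    if "X \<in> \<X> x" "A = D x \<or> A = E x" for X x A
    using that step_U[OF that(1)] step(5)[of x] DE_in[of x] absorb1 by metis

  \<comment> \<open>Maximality\<close>
  have maximal: "maximal_ideal_independent I"
    unfolding maximal_ideal_independent_def
  proof (intro conjI allI impI indep)
    fix K assume K: "ideal_independent K \<and> I \<subseteq> K"
    have "B \<in> I" if B: "B \<in> K" for B
    proof (rule ccontr)
      assume BI: "B \<notin> I"
      then have ne: "B \<noteq> D B" "B \<noteq> E B"
        using DE_in by metis+
      \<comment> \<open>Otherwise \<open>A\<close> would be almost covered by \<open>V\<close> and
        \<open>B\<close>, two other members of \<open>K\<close>. Each alternative of
        \<open>step_max\<close> at stage \<open>B\<close> now leads to a contradiction.\<close>
      have no_cover: "\<not> A - V \<subseteq>* B" if "A \<in> I" "V \<in> I" "A \<noteq> V" for A V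
      proof -
        have "infinite (A - \<Union>{V, B})"
          using K B that BI by (intro ideal_independentD[of K]) auto
        then show ?thesis
          by (simp add: almost_subset_def Diff_Diff_Int Diff_eq Int_assoc)
      qed
      have "B \<notin> filter_sets U"
        using no_cover[OF DE_in step(5)] step_U[of B B] by (auto simp: \<X>_def)
      moreover have "\<not> B \<subseteq> D B \<inter> E B"
      proof
        assume "B \<subseteq> D B \<inter> E B"
        then have "B - D B = {}" by blast
        then show False
          using ideal_independent_diff[of K B "D B"] K B DE_in(1)[of B] ne(1)
          by (metis finite.emptyI subsetD)
      qed
      ultimately obtain A where "A \<in> J B" "A - D B \<subseteq>* B"
        using step_max[of B] by blast
      moreover have "A \<in> I" "A \<noteq> D B"
        using calculation(1) J_le D_new by auto
      ultimately show False
        using no_cover[OF _ DE_in(1)] by blast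
    qed
    with K show "K = I" by blast
  qed

  \<comment> \<open>The family is encompassing\<close>
  have "countable (I - {A\<in>I. X \<in> filter_sets (complemented_filter I A)})"
    if X: "X \<in> filter_sets U" for X
  proof (rule countable_subset)
    \<comment> \<open>From stage \<open>X\<close> on, \<open>X\<close> belongs to
      \<open>\<X> x\<close>, so exceptions can only come from the countably many earlier
      stages.\<close>
    show "I - {A\<in>I. X \<in> filter_sets (complemented_filter I A)} \<subseteq> J X"
    proof
      fix A assume A: "A \<in> I - {A\<in>I. X \<in> filter_sets (complemented_filter I A)}"
      then obtain x where x: "A = D x \<or> A = E x"
        by (auto simp: I_eq)
      then have "X \<notin> \<X> x"
        using CF_U A by blast
      then have "x \<in> below X"
        using X lt(3) unfolding \<X>_def below_def total_on_def by auto
      with x show "A \<in> J X" by (auto simp: J_eq)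
    qed
    show "countable (J X)"
      using initial[of X] by (simp add: J_eq below_def)
  qed
  then have "encompassing U I"
    using maximal I_U by (simp add: encompassing_def)

  \<comment> \<open>The complemented filters are p-points\<close>
  moreover have "p_point (complemented_filter I A)" if A: "A \<in> I" for A
    unfolding p_point_def
  proof (intro conjI allI impI)
    define CF where "CF = filter_sets (complemented_filter I A)"
    have CF_inf: "infinite X" if "X \<in> CF" for X
      using that ideal_independentD[OF indep _ _ A]
      unfolding CF_def filter_sets_complemented_filter by (meson finite_subset)
    obtain x where x: "A = D x \<or> A = E x"
      using A by (auto simp: I_eq)
    \<comment> \<open>If \<open>A\<close> was present before stage \<open>B\<close>, then
      \<open>A - D B\<close> decides \<open>B\<close>. Otherwise \<open>A\<close> was added at a
      stage \<open>x\<close> not before \<open>B\<close>, and \<open>\<X> x\<close> contains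
      \<open>B\<close> or its complement.\<close>
    have "B \<in> CF \<or> - B \<in> CF" for B
    proof (cases "A \<in> J B")
      case True
      then show ?thesis
        using step_decide[OF True] absorb1[OF DE_in(1) D_new[OF True]] by (auto simp: CF_def)
    next
      case False
      then have "x \<notin> below B"
        using x by (auto simp: J_eq)
      then have *: "B \<in> insert x (below x)"
        using lt(3) by (auto simp: below_def total_on_def)
      show ?thesis
      proof (cases "B \<in> filter_sets U")
        case True
        with * have "B \<in> \<X> x" by (auto simp: \<X>_def)
        then show ?thesis using CF_U x by (simp add: CF_def)
      next
        case False
        with * have "- B \<in> \<X> x"
          using ultrafilter_Compl[OF ultra] by (auto simp: \<X>_def)
        then show ?thesis using CF_U x by (simp add: CF_def)
      qed
    qed
    moreover have "complemented_filter I A \<noteq> bot"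
      using CF_inf[of "{}"] by (auto simp: CF_def filter_sets_def)
    ultimately show "ultrafilter (complemented_filter I A)"
      by (simp add: ultrafilter_def CF_def)
    show "nonprincipal (complemented_filter I A)"
      unfolding nonprincipal_def
    proof (intro allI notI)
      fix S assume "complemented_filter I A = principal S"
      then have CF: "CF = {X. S \<subseteq> X}"
        by (auto simp: CF_def filter_sets_def eventually_principal)
      then have "infinite S" using CF_inf by blast
      then obtain n where n: "n \<in> S"
        by (metis ex_in_conv finite.emptyI)
      have "- {n} \<in> CF"
        unfolding CF_def by (rule absorb[of "{}"]) (auto simp: almost_subset_def intro: finite_subset[of _ "{n}"])
      with CF n show False by blast
    qed
    fix \<C> assume "\<C> \<subseteq> filter_sets (complemented_filter I A) \<and> countable \<C>"
    then have \<C>: "\<And>X. X \<in> \<C> \<Longrightarrow> \<exists>F. finite F \<and> F \<subseteq> I \<and> A \<notin> F \<and> A - \<Union>F \<subseteq> X" "countable \<C>"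
      by (auto simp: filter_sets_complemented_filter subset_iff)
    then obtain F where F: "\<And>X. X \<in> \<C> \<Longrightarrow> finite (F X)" "\<And>X. X \<in> \<C> \<Longrightarrow> F X \<subseteq> I"
      "\<And>X. X \<in> \<C> \<Longrightarrow> A \<notin> F X" "\<And>X. X \<in> \<C> \<Longrightarrow> A - \<Union>(F X) \<subseteq> X"
      by metis
    have "\<forall>V\<in>I. \<exists>y. V = D y \<or> V = E y"
      by (auto simp: I_eq)
    then obtain s where s: "\<And>V. V \<in> I \<Longrightarrow> V = D (s V) \<or> V = E (s V)"
      by metis
    have "countable (s ` (insert A (\<Union>(F ` \<C>))))"
      by (intro countable_image countable_insert countable_UN \<C>(2) countable_finite[OF F(1)])
    \<comment> \<open>Some stage \<open>y\<close> comes after the addition of \<open>A\<close> and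
      of the countably many sets used to witness that the members of \<open>\<C>\<close> are in the
      filter. The pseudo-intersection is \<open>A - D y\<close>: it meets each set in
      \<open>F X\<close> finitely, while \<open>A - \<Union>(F X)\<close> is contained in
      \<open>X\<close>.\<close>
    then obtain y where y: "\<forall>z\<in>s ` (insert A (\<Union>(F ` \<C>))). (z, y) \<in> lt"
      using bounded by blast
    have inJ: "V \<in> J y" if "V \<in> insert A (\<Union>(F ` \<C>))" for V
    proof -
      have "V \<in> I" using that A F(2) by blast
      moreover have "s V \<in> below y" using y that unfolding below_def by blast
      ultimately show ?thesis using s[of V] by (auto simp: J_eq)
    qed
    have AJ: "A \<in> J y" using inJ by blast
    have mem: "A - D y \<in> CF"
      unfolding CF_def by (rule absorb1[OF DE_in(1) D_new[OF AJ]]) (simp add: almost_subset_def)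
    have "A - D y \<subseteq>* X" if X: "X \<in> \<C>" for X
    proof -
      have "finite (\<Union>V\<in>F X. (A - D y) \<inter> V)"
      proof (rule finite_UN_I[OF F(1)[OF X]])
        fix V assume "V \<in> F X"
        then show "finite ((A - D y) \<inter> V)"
          using step_pseudo[OF AJ inJ] X F(3)[OF X] by blast
      qed
      moreover have "A - D y - X \<subseteq> (\<Union>V\<in>F X. (A - D y) \<inter> V)"
        using F(4)[OF X] by blast
      ultimately show ?thesis
        unfolding almost_subset_def by (rule rev_finite_subset)
    qed
    then show "\<exists>B\<in>filter_sets (complemented_filter I A). pseudo_intersection B \<C>"
      using mem CF_inf[OF mem] by (auto simp: CF_def pseudo_intersection_def)
  qed
  ultimately show ?thesis by blast
qed

end
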